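(* Let $\Delta$ denote the forward difference operator, $\Delta^n f(s)=\sum_{\nu=0}^n(-1)^{n-\nu}\binom{n}{\nu}f(s+\nu)$ for integers $n\ge 0$. For $n\ge 1$ put \[ a_n=\frac{(-1)^{n+1}}{2^n}\,\Delta^n \log x\Big|_{x=1},\qquad l_n=(-1)^{n+1}\,\Delta^n\log x\Big|_{x=1}. \] Then: (i) the function $\mathcal{L}(s)=\sum_{n\ge1}a_n n^{-s}$ is an entire function of $s\in\mathbb{C}$, and $a_n=o(2^{-n})$ as $n\to\infty$; (ii) $l_n\in(0,\log 2]$ for all $n\ge1$, and $(l_n)_{n\ge1}$ is strictly decreasing with limit $0$; (iii) the linear functional $\mathcal{L}^\star:\mathbb{C}[x]\to\mathbb{C}$, $\mathcal{L}^\star(f)=\sum_{n\ge1}a_n f(n)$, is given by an absolutely convergent series for every $f\in\mathbb{C}[x]$; (iv) $\mathcal{L}(0)=\mathcal{L}^\star(1)=\log(\pi/2)$.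
   Context: $o(\cdot)$ is Landau's little-$o$ symbol. The notation $g(x)|_{x=1}$ means that the difference operator acts on the variable $x$ and the result is evaluated at $x=1$. *)

theory Defs
  imports
    "HOL-Complex_Analysis.Complex_Analysis"
    "HOL-Computational_Algebra.Polynomial"
    "HOL-Library.Landau_Symbols"
begin

definition forward_diff :: "nat \<Rightarrow> (real \<Rightarrow> real) \<Rightarrow> real \<Rightarrow> real" where
  "forward_diff n f s =
     (\<Sum>\<nu>=0..n. (-1) ^ (n - \<nu>) * real (n choose \<nu>) * f (s + real \<nu>))"

definition a_seq :: "nat \<Rightarrow> real" where
  "a_seq n = (-1) ^ (n + 1) / 2 ^ n * forward_diff n ln 1"

definition l_seq :: "nat \<Rightarrow> real" where
  "l_seq n = (-1) ^ (n + 1) * forward_diff n ln 1"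

text \<open>The series over \<open>n \<ge> 1\<close> are indexed by \<open>Suc n\<close>.  As \<^const>\<open>suminf\<close> is a total function,
  convergence has to be claimed separately wherever these sums are used.\<close>

definition L_term :: "complex \<Rightarrow> nat \<Rightarrow> complex" where
  "L_term s n = complex_of_real (a_seq n) * of_nat n powr (- s)"

definition L_fun :: "complex \<Rightarrow> complex" where
  "L_fun s = (\<Sum>n. L_term s (Suc n))"

definition L_star_term :: "complex poly \<Rightarrow> nat \<Rightarrow> complex" where
  "L_star_term f n = complex_of_real (a_seq n) * poly f (of_nat n)"

definition L_star :: "complex poly \<Rightarrow> complex" where
  "L_star f = (\<Sum>n. L_star_term f (Suc n))"

end

theory Submission
  imports Defs "HOL-Real_Asymp.Real_Asymp"
begin

text \<open>
  Put \<open>g\<^sub>n(s) = (-1)\<^sup>n\<^sup>+\<^sup>1 \<Delta>\<^sup>n log s\<close>, so that \<open>l\<^sub>n = g\<^sub>n(1)\<close> and \<open>g\<^sub>n\<^sub>+\<^sub>1(s) = g\<^sub>n(s) - g\<^sub>n(s + 1)\<close>.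
  As \<open>g\<^sub>n'(s) = -n!/(s(s+1)\<dots>(s+n))\<close> is negative and \<open>g\<^sub>n\<close> vanishes at infinity for \<open>n \<ge> 1\<close>,
  \<open>g\<^sub>n\<close> is positive, whence \<open>l\<^sub>n\<close> decreases.  The bound \<open>-g\<^sub>n'(s) \<le> 1/(H\<^sub>n s\<^sup>2)\<close> with the harmonic
  number \<open>H\<^sub>n\<close> gives \<open>l\<^sub>n \<le> 1/H\<^sub>n\<close>, which tends to \<open>0\<close>.
  The value at \<open>0\<close> comes from Euler's series transformation: the alternating sums
  \<open>E\<^sub>n = \<Sum>\<^sub>j (-1)\<^sup>j g\<^sub>n(1 + j)\<close> satisfy \<open>2 E\<^sub>n = l\<^sub>n + E\<^sub>n\<^sub>+\<^sub>1\<close> and \<open>0 \<le> E\<^sub>n \<le> l\<^sub>n\<close>, so that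
  \<open>\<Sum>\<^sub>n l\<^sub>n/2\<^sup>n = E\<^sub>1\<close>, and \<open>E\<^sub>1\<close> is the logarithm of Wallis' product.
\<close>

section \<open>Forward differences and their values on the reciprocal function\<close>

lemma forward_diff_0 [simp]: "forward_diff 0 f s = f s"
  by (simp add: forward_diff_def)

text \<open>Pascal's rule splits each coefficient in two; one half shifts the argument, the other
  only changes sign.\<close>

lemma forward_diff_Suc:
  "forward_diff (Suc n) f s = forward_diff n f (s + 1) - forward_diff n f s"
proof -
  let ?c = "\<lambda>k m. (-1) ^ (Suc n - k) * real m * f (s + real k)"
  have "forward_diff (Suc n) f s =
      ?c 0 1 + (\<Sum>k=0..n. ?c (Suc k) (n choose k) + ?c (Suc k) (n choose Suc k))"
    unfolding forward_diff_def by (subst sum.atLeast0_atMost_Suc_shift) (simp add: algebra_simps)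
  also have "\<dots> = (\<Sum>k=0..n. ?c (Suc k) (n choose k)) +
      (?c 0 (n choose 0) + (\<Sum>k=0..n. ?c (Suc k) (n choose Suc k)))"
    by (simp add: sum.distrib)
  also have "?c 0 (n choose 0) + (\<Sum>k=0..n. ?c (Suc k) (n choose Suc k)) =
      (\<Sum>k=0..Suc n. ?c k (n choose k))"
    by (subst sum.atLeast0_atMost_Suc_shift) simp
  also have "\<dots> = (\<Sum>k=0..n. ?c k (n choose k))"
    by simp
  also have "\<dots> = - forward_diff n f s"
    unfolding forward_diff_def sum_negf [symmetric]
    by (intro sum.cong) (auto simp: Suc_diff_le)
  also have "(\<Sum>k=0..n. ?c (Suc k) (n choose k)) = forward_diff n f (s + 1)"
    unfolding forward_diff_def by (intro sum.cong) (auto simp: add_ac)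
  finally show ?thesis by simp
qed

lemma DERIV_forward_diff:
  assumes "\<And>x. x \<ge> s \<Longrightarrow> (f has_real_derivative f' x) (at x)"
  shows "(forward_diff n f has_real_derivative forward_diff n f' s) (at s)"
proof -
  have "((\<lambda>x. f (x + real \<nu>)) has_real_derivative f' (s + real \<nu>)) (at s)" for \<nu>
    using assms[of "s + real \<nu>"] by (simp add: DERIV_shift)
  then show ?thesis
    unfolding forward_diff_def by (intro DERIV_sum DERIV_cmult)
qed

text \<open>The Pochhammer symbols at \<open>s\<close> and \<open>s + 1\<close> share the factor
  \<open>pochhammer (s + 1) n\<close>, so the induction step reduces to
  \<open>1/(s + 1 + n) - 1/s = -(n + 1)/(s * (s + 1 + n))\<close>.\<close>

lemma forward_diff_inverse:
  assumes "s > 0"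
  shows "forward_diff n inverse s = (-1) ^ n * fact n / pochhammer s (Suc n)"
  using assms
proof (induction n arbitrary: s)
  case 0
  then show ?case by (simp add: field_simps)
next
  case (Suc n)
  let ?p = "pochhammer (s + 1) n"
  have p: "?p > 0"
    using Suc.prems by (intro pochhammer_pos) auto
  have 1: "pochhammer s (Suc n) = s * ?p"
    by (rule pochhammer_rec)
  have 2: "pochhammer (s + 1) (Suc n) = ?p * (s + 1 + n)"
    by (simp add: pochhammer_Suc)
  have 3: "pochhammer s (Suc (Suc n)) = s * ?p * (s + 1 + n)"
    by (subst pochhammer_rec) (simp add: 2)
  have "forward_diff (Suc n) inverse s =
      (-1) ^ n * fact n / (?p * (s + 1 + n)) - (-1) ^ n * fact n / (s * ?p)"
    using Suc by (simp only: forward_diff_Suc Suc.IH 1 2)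
  also have "\<dots> = (-1) ^ Suc n * fact (Suc n) / (s * ?p * (s + 1 + n))"
    using p Suc.prems by (simp add: divide_simps) (simp add: algebra_simps)
  finally show ?case by (simp only: 3)
qed

text \<open>The left side is \<open>s * fact n\<close> times the product of the factors
  \<open>1 + s/k\<close> for \<open>k = 1..n\<close>; expanding it and keeping only the constant and
  linear terms gives the bound.\<close>

lemma pochhammer_ge_harm:
  fixes s :: real
  assumes "s > 0"
  shows "pochhammer s (Suc n) \<ge> s * fact n * (1 + s * harm n)"
proof (induction n)
  case 0
  then show ?case by (simp add: harm_def)
next
  case (Suc n)
  have h: "harm n \<ge> (0::real)"
    by (rule harm_nonneg)
  have "s * fact (Suc n) * (1 + s * harm (Suc n)) \<le>
      s * fact n * ((1 + s * harm n) * (1 + s / Suc n) * Suc n)"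
  proof -
    have "1 + s * harm (Suc n) = 1 + s * harm n + s / Suc n"
      by (simp add: harm_Suc field_simps)
    also have "\<dots> \<le> 1 + s * harm n + s / Suc n + (s * harm n) * (s / Suc n)"
      using h assms by simp
    also have "\<dots> = (1 + s * harm n) * (1 + s / Suc n)"
      by (simp add: algebra_simps add_divide_distrib)
    finally have "(1 + s * harm (Suc n)) * Suc n \<le> (1 + s * harm n) * (1 + s / Suc n) * Suc n"
      by (rule mult_right_mono) simp
    then have "(s * fact n) * ((1 + s * harm (Suc n)) * Suc n)
        \<le> (s * fact n) * ((1 + s * harm n) * (1 + s / Suc n) * Suc n)"
      by (rule mult_left_mono) (use assms in simp)
    then show ?thesis by (simp add: mult_ac)
  qed
  also have "\<dots> = s * fact n * (1 + s * harm n) * (s + Suc n)"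
    by (simp add: field_simps)
  also have "\<dots> \<le> pochhammer s (Suc n) * (s + Suc n)"
    by (rule mult_right_mono[OF Suc.IH]) (use assms in simp)
  finally show ?case by (simp add: pochhammer_Suc [of s "Suc n"])
qed

lemma pos_of_decreasing_tendsto_0:
  fixes f :: "real \<Rightarrow> real"
  assumes deriv: "\<And>x. x > 0 \<Longrightarrow> \<exists>y. (f has_real_derivative y) (at x) \<and> y < 0"
    and lim: "(f \<longlongrightarrow> 0) at_top" and "s > 0"
  shows "f s > 0"
proof -
  have dec: "f y < f x" if "0 < x" "x < y" for x y
    using that deriv by (intro DERIV_neg_imp_decreasing[of x y f]) auto
  \<comment> \<open>Passing to the limit only yields a weak inequality; the intermediate point
    \<open>s + 1\<close> restores strictness at \<open>s\<close>.\<close>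
  have "0 \<le> f (s + 1)"
  proof (rule tendsto_upperbound[OF lim])
    show "\<forall>\<^sub>F y in at_top. f y \<le> f (s + 1)"
      using eventually_gt_at_top[of "s + 1"]
      by eventually_elim (use dec \<open>s > 0\<close> in \<open>auto intro: less_imp_le\<close>)
  qed simp
  then show ?thesis
    using dec[of s "s + 1"] \<open>s > 0\<close> by simp
qed

section \<open>Signed differences of the logarithm\<close>

definition ln_diff :: "nat \<Rightarrow> real \<Rightarrow> real" where
  "ln_diff n s = (-1) ^ (n + 1) * forward_diff n ln s"

lemma l_seq_eq: "l_seq n = ln_diff n 1"
  by (simp add: l_seq_def ln_diff_def)

lemma a_seq_eq: "a_seq n = ln_diff n 1 / 2 ^ n"
  by (simp add: a_seq_def ln_diff_def)

lemma ln_diff_Suc: "ln_diff (Suc n) s = ln_diff n s - ln_diff n (s + 1)"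
  by (simp add: ln_diff_def forward_diff_Suc algebra_simps)

lemma ln_diff_1: "ln_diff (Suc 0) s = ln (s + 1) - ln s"
  by (simp add: ln_diff_def forward_diff_Suc)

lemma DERIV_ln_diff:
  assumes "s > 0"
  shows "(ln_diff n has_real_derivative - fact n / pochhammer s (Suc n)) (at s)"
proof -
  have "(forward_diff n ln has_real_derivative forward_diff n inverse s) (at s)"
    using assms by (intro DERIV_forward_diff DERIV_ln) auto
  from DERIV_cmult[OF this, of "(-1) ^ (n + 1)"] show ?thesis
    using assms
    by (simp add: ln_diff_def [abs_def] forward_diff_inverse flip: power_mult_distrib)
qed

text \<open>The index starts at 1 because \<open>ln_diff 0\<close> is \<open>- ln\<close>, which
  diverges.\<close>

lemma ln_diff_tendsto_0: "(ln_diff (Suc n) \<longlongrightarrow> 0) at_top"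
proof (induction n)
  case 0
  show ?case unfolding ln_diff_1 [abs_def] by real_asymp
next
  case (Suc n)
  have "((\<lambda>s. ln_diff (Suc n) (s + 1)) \<longlongrightarrow> 0) at_top"
    by (rule filterlim_compose[OF Suc.IH]) real_asymp
  from tendsto_diff[OF Suc.IH this] show ?case
    by (simp add: ln_diff_Suc[abs_def])
qed

lemma ln_diff_pos:
  assumes "s > 0"
  shows "ln_diff (Suc n) s > 0"
proof (rule pos_of_decreasing_tendsto_0[OF _ ln_diff_tendsto_0 assms])
  fix x :: real
  assume "x > 0"
  then have "- fact (Suc n) / pochhammer x (Suc (Suc n)) < 0"
    by (intro divide_neg_pos pochhammer_pos) auto
  with DERIV_ln_diff[OF \<open>x > 0\<close>]
  show "\<exists>y. (ln_diff (Suc n) has_real_derivative y) (at x) \<and> y < 0"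
    by blast
qed

lemma ln_diff_Suc_less: "s > 0 \<Longrightarrow> ln_diff (Suc (Suc n)) s < ln_diff (Suc n) s"
  using ln_diff_pos[of "s + 1" n] by (simp add: ln_diff_Suc[of "Suc n"])

lemma ln_diff_add_1_le: "s > 0 \<Longrightarrow> ln_diff (Suc n) (s + 1) \<le> ln_diff (Suc n) s"
  using ln_diff_pos[of s "Suc n"] by (simp add: ln_diff_Suc[of "Suc n"])

text \<open>The gap between the two sides vanishes at infinity and has negative derivative, so it is
  positive.\<close>

lemma ln_diff_less_inverse_harm:
  assumes "s > 0"
  shows "ln_diff (Suc n) s < 1 / (harm (Suc n) * s)"
proof -
  let ?h = "harm (Suc n) :: real"
  have h: "?h > 0"
    by (rule harm_pos) simp
  have "0 < 1 / (?h * s) - ln_diff (Suc n) s"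
  proof (rule pos_of_decreasing_tendsto_0[OF _ _ assms])
    have "((\<lambda>s. 1 / (c * s)) \<longlongrightarrow> 0) at_top" if "c > 0" for c :: real
      using that by real_asymp
    from tendsto_diff[OF this[OF h] ln_diff_tendsto_0[of n]]
    show "((\<lambda>s. 1 / (?h * s) - ln_diff (Suc n) s) \<longlongrightarrow> 0) at_top"
      by simp
  next
    fix x :: real
    assume x: "x > 0"
    let ?P = "pochhammer x (Suc (Suc n))"
    have "((\<lambda>s. 1 / (?h * s) - ln_diff (Suc n) s) has_real_derivative
        - (1 / (?h * x\<^sup>2)) - (- fact (Suc n) / ?P)) (at x)"
      using x less_imp_neq[OF h, symmetric]
      by (intro DERIV_diff DERIV_ln_diff)
         (auto intro!: derivative_eq_intros simp: power2_eq_square field_simps)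
    moreover have "fact (Suc n) / ?P < 1 / (?h * x\<^sup>2)"
    proof -
      \<comment> \<open>Dropping the summand 1 from the lower bound for \<open>?P\<close> makes the
        inequality strict.\<close>
      have "fact (Suc n) * (?h * x\<^sup>2) < x * fact (Suc n) * (1 + x * ?h)"
      proof -
        have "x * fact (Suc n) > 0"
          using x by (intro mult_pos_pos) auto
        then show ?thesis
          by (simp add: algebra_simps power2_eq_square del: fact_Suc)
      qed
      also have "\<dots> \<le> ?P"
        by (rule pochhammer_ge_harm[OF x])
      finally have "fact (Suc n) * (?h * x\<^sup>2) < ?P" .
      moreover have "?P > 0"
        using x by (rule pochhammer_pos)
      ultimately show ?thesis
        using h x by (simp add: divide_less_eq less_divide_eq mult_ac del: fact_Suc)
    qed
    ultimately show "\<exists>y. ((\<lambda>s. 1 / (?h * s) - ln_diff (Suc n) s) has_real_derivative y) (at x)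
        \<and> y < 0"
      by (intro exI conjI) (assumption, simp del: fact_Suc)
  qed
  then show ?thesis by simp
qed

section \<open>Limit, monotonicity and range of \<open>l_seq\<close>\<close>

lemma l_seq_tendsto_0: "l_seq \<longlonglongrightarrow> 0"
proof -
  have "(\<lambda>n. l_seq (Suc n)) \<longlonglongrightarrow> 0"
  proof (rule tendsto_sandwich[of "\<lambda>_. 0" _ _ "\<lambda>n. inverse (harm (Suc n))"])
    have "filterlim (\<lambda>n. harm (Suc n) :: real) at_top sequentially"
      using harm_at_top filterlim_sequentially_Suc by blast
    then show "(\<lambda>n. inverse (harm (Suc n)) :: real) \<longlonglongrightarrow> 0"
      by (rule tendsto_inverse_0_at_top)
    show "\<forall>\<^sub>F n in sequentially. l_seq (Suc n) \<le> inverse (harm (Suc n))"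
      using ln_diff_less_inverse_harm[of 1]
      by (auto simp: l_seq_eq inverse_eq_divide intro!: always_eventually less_imp_le)
    show "\<forall>\<^sub>F n in sequentially. 0 \<le> l_seq (Suc n)"
      using ln_diff_pos[of 1] by (auto simp: l_seq_eq intro!: always_eventually less_imp_le)
  qed simp
  then show ?thesis
    by (simp only: filterlim_sequentially_Suc)
qed

text \<open>Index 0 has to be excluded, since \<open>l_seq 0 = - ln 1 = 0\<close>.\<close>

lemma l_seq_strict_antimono: "strict_antimono_on {1..} l_seq"
proof (rule monotone_onI)
  fix m n :: nat
  assume "m \<in> {1..}" "m < n"
  have *: "l_seq (Suc m') > l_seq (Suc n')" if "m' < n'" for m' n'
  proof -
    \<comment> \<open>The sign is flipped because \<open>lift_Suc_mono_less\<close> is about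
      increasing sequences.\<close>
    have "- l_seq (Suc k) < - l_seq (Suc (Suc k))" for k
      using ln_diff_Suc_less[of 1 k] by (simp add: l_seq_eq)
    from lift_Suc_mono_less[of "\<lambda>k. - l_seq (Suc k)", OF this that] show ?thesis
      by simp
  qed
  show "l_seq m > l_seq n"
    using *[of "m - 1" "n - 1"] \<open>m \<in> {1..}\<close> \<open>m < n\<close> by simp
qed

lemma l_seq_range:
  assumes "n \<ge> 1"
  shows "l_seq n \<in> {0<..ln 2}"
proof -
  obtain m where n: "n = Suc m"
    using assms by (cases n) auto
  have "l_seq n \<le> l_seq 1"
    using monotone_onD[OF l_seq_strict_antimono, of 1 n] assms
    by (cases "n = 1") auto
  then show ?thesis
    using ln_diff_pos[of 1 m] by (simp add: n l_seq_eq ln_diff_1)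
qed

section \<open>Euler's transformation and Wallis' product\<close>

lemma alternating_ln_diff:
  shows "summable (\<lambda>j. (-1) ^ j * ln_diff (Suc n) (1 + real j))"
    and "(\<Sum>j. (-1) ^ j * ln_diff (Suc n) (1 + real j)) \<in> {0..ln_diff (Suc n) 1}"
proof -
  let ?g = "\<lambda>j. ln_diff (Suc n) (1 + real j)"
  have lim: "?g \<longlonglongrightarrow> 0"
    by (rule filterlim_compose[OF ln_diff_tendsto_0]) real_asymp
  have nonneg: "0 \<le> ?g j" for j
    using ln_diff_pos[of "1 + real j" n] by simp
  have dec: "?g (Suc j) \<le> ?g j" for j
    using ln_diff_add_1_le[of "1 + real j" n] by (simp add: add_ac)
  note leib = summable_Leibniz'[of ?g, OF lim nonneg dec]
  show "summable (\<lambda>j. (-1) ^ j * ?g j)"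
    by (rule leib(1))
  show "(\<Sum>j. (-1) ^ j * ?g j) \<in> {0..ln_diff (Suc n) 1}"
    \<comment> \<open>The value of the series lies between its partial sums of length 0 and
      1.\<close>
    using leib(2)[of 0] leib(4)[of 0] by simp
qed

text \<open>By \<open>ln_diff_Suc\<close> the new terms are \<open>?t j + ?t (Suc j)\<close>, and
  the shifted series lacks only \<open>?t 0\<close>.\<close>

lemma alternating_ln_diff_Suc:
  "(\<Sum>j. (-1) ^ j * ln_diff (Suc (Suc n)) (1 + real j)) =
    2 * (\<Sum>j. (-1) ^ j * ln_diff (Suc n) (1 + real j)) - ln_diff (Suc n) 1"
proof -
  let ?t = "\<lambda>j. (-1) ^ j * ln_diff (Suc n) (1 + real j)"
  have s: "?t sums suminf ?t"
    using alternating_ln_diff(1) by (rule summable_sums)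
  then have "(\<lambda>j. ?t (Suc j)) sums (suminf ?t - ?t 0)"
    by (subst sums_Suc_iff) simp
  from sums_add[OF s this]
  have "(\<lambda>j. (-1) ^ j * ln_diff (Suc (Suc n)) (1 + real j)) sums
      (suminf ?t + (suminf ?t - ?t 0))"
    by (simp add: ln_diff_Suc[of "Suc n"] algebra_simps)
  then show ?thesis
    by (simp add: sums_iff)
qed

text \<open>Terms \<open>2 * n\<close> and \<open>2 * n + 1\<close> together are the logarithm of
  the Wallis factor for \<open>k = n + 1\<close>. As the series converges, its even partial sums
  determine its value.\<close>

lemma alternating_ln_diff_1:
  "(\<Sum>j. (-1) ^ j * ln_diff (Suc 0) (1 + real j)) = ln (pi / 2)"
proof -
  let ?t = "\<lambda>j. (-1) ^ j * ln_diff (Suc 0) (1 + real j)"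
  have pos: "4 * (real k)\<^sup>2 - 1 > 0" if "k \<ge> 1" for k
  proof -
    have "real k * real k \<ge> 1 * 1"
      using that by (intro mult_mono) auto
    then show ?thesis by (simp add: power2_eq_square)
  qed
  have partial: "(\<Sum>j<2*n. ?t j) = ln (\<Prod>k=1..n. (4 * (real k)\<^sup>2) / (4 * (real k)\<^sup>2 - 1))" for n
  proof (induction n)
    case (Suc n)
    let ?P = "\<Prod>k=1..n. (4 * (real k)\<^sup>2) / (4 * (real k)\<^sup>2 - 1)"
    have P: "?P > 0"
      by (intro prod_pos) (auto intro!: divide_pos_pos pos)
    have fac: "(4 * (real (Suc n))\<^sup>2) / (4 * (real (Suc n))\<^sup>2 - 1) =
        ((2 * real n + 2) * (2 * real n + 2)) / ((2 * real n + 1) * (2 * real n + 3))"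
      by (rule arg_cong2[where f = "(/)"]) (auto simp: power2_eq_square algebra_simps)
    have "(\<Sum>j<2 * Suc n. ?t j) = ln ?P + (?t (2 * n) + ?t (Suc (2 * n)))"
      using Suc.IH by simp
    also have "?t (2 * n) + ?t (Suc (2 * n)) =
        ln (((2 * real n + 2) * (2 * real n + 2)) / ((2 * real n + 1) * (2 * real n + 3)))"
    proof -
      have "ln ((a * a) / (b * c)) = (ln a - ln b) - (ln c - ln a)"
        if "a > 0" "b > 0" "c > 0" for a b c :: real
        using that by (simp add: ln_div ln_mult)
      then have "ln (((2 * real n + 2) * (2 * real n + 2)) / ((2 * real n + 1) * (2 * real n + 3))) =
          (ln (2 * real n + 2) - ln (2 * real n + 1)) - (ln (2 * real n + 3) - ln (2 * real n + 2))"
        by simp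
      moreover have "1 + real (2 * n) + 1 = 2 * real n + 2" "1 + real (2 * n) = 2 * real n + 1"
          "1 + real (Suc (2 * n)) + 1 = 2 * real n + 3" "1 + real (Suc (2 * n)) = 2 * real n + 2"
        by simp_all
      ultimately show ?thesis
        by (simp only: ln_diff_1) simp
    qed
    also have "ln ?P + \<dots> = ln (?P * (((2 * real n + 2) * (2 * real n + 2)) /
        ((2 * real n + 1) * (2 * real n + 3))))"
      by (rule ln_mult_pos [OF P, symmetric]) simp
    also have "\<dots> = ln (\<Prod>k=1..Suc n. (4 * (real k)\<^sup>2) / (4 * (real k)\<^sup>2 - 1))"
      by (simp only: fac prod.nat_ivl_Suc' le_add2 One_nat_def Suc_le_mono le0 mult.commute)
    finally show ?case .
  qed simp
  have "(\<lambda>n. \<Sum>j<2*n. ?t j) \<longlonglongrightarrow> ln (pi / 2)"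
    unfolding partial by (intro tendsto_ln wallis) simp
  moreover have "(\<lambda>n. \<Sum>j<2*n. ?t j) \<longlonglongrightarrow> suminf ?t"
    using alternating_ln_diff(1)[of 0, THEN summable_LIMSEQ]
    by (rule filterlim_compose) (auto intro: mult_nat_left_at_top)
  ultimately show ?thesis
    by (blast intro: LIMSEQ_unique)
qed

lemma a_seq_sums: "(\<lambda>n. a_seq (Suc n)) sums ln (pi / 2)"
proof -
  \<comment> \<open>\<open>E n\<close> belongs to the difference of order \<open>n + 1\<close>, so
    \<open>E 0\<close> is \<open>ln (pi / 2)\<close>. The partial sums telescope because
    \<open>a_seq (Suc N) = E N / 2 ^ N - E (Suc N) / 2 ^ Suc N\<close>.\<close>
  define E where "E n = (\<Sum>j. (-1) ^ j * ln_diff (Suc n) (1 + real j))" for n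
  have partial: "(\<Sum>n<N. a_seq (Suc n)) = ln (pi / 2) - E N / 2 ^ N" for N
  proof (induction N)
    case 0
    show ?case by (simp add: E_def alternating_ln_diff_1)
  next
    case (Suc N)
    then show ?case
      using alternating_ln_diff_Suc[of N] by (simp add: E_def a_seq_eq field_simps)
  qed
  have E: "0 \<le> E N" "E N \<le> ln 2" for N
    using alternating_ln_diff(2)[of N] l_seq_range[of "Suc N"] by (auto simp: E_def l_seq_eq)
  have "(\<lambda>N. E N / 2 ^ N) \<longlonglongrightarrow> 0"
  proof (rule tendsto_sandwich[of "\<lambda>_. 0" _ _ "\<lambda>N. ln 2 / 2 ^ N"])
    show "(\<lambda>N. ln 2 / 2 ^ N :: real) \<longlonglongrightarrow> 0"
      by real_asymp
  qed (use E in \<open>auto intro!: always_eventually divide_right_mono\<close>)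
  from tendsto_diff[OF tendsto_const this, of "ln (pi / 2)"] show ?thesis
    by (simp add: sums_def partial)
qed

section \<open>Decay of the coefficients and convergence of both series\<close>

lemma a_seq_smallo: "a_seq \<in> o[at_top](\<lambda>n. 1 / 2 ^ n)"
proof (rule smalloI_tendsto)
  show "(\<lambda>n. a_seq n / (1 / 2 ^ n)) \<longlonglongrightarrow> 0"
    using l_seq_tendsto_0 by (simp add: a_seq_eq l_seq_eq[abs_def])
qed simp

lemma norm_a_seq_le:
  assumes "n \<ge> 1"
  shows "norm (a_seq n) \<le> 1 / 2 ^ n"
proof -
  have "ln_diff n 1 > 0" "ln_diff n 1 \<le> 1"
    using l_seq_range[OF assms] ln_2_less_1 by (auto simp: l_seq_eq)
  then show ?thesis
    by (simp add: a_seq_eq divide_right_mono)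
qed

text \<open>This is the common majorant for the Dirichlet series and the functional.\<close>

lemma summable_powr_div_power2: "summable (\<lambda>n. real (Suc n) powr r / 2 ^ Suc n)"
proof -
  \<comment> \<open>Any ratio strictly between 1 and 2 would do; \<open>3 / 2\<close> leaves a
    geometric series of ratio \<open>3 / 4\<close>.\<close>
  have "(\<lambda>n. real n powr r) \<in> O(\<lambda>n. (3 / 2 :: real) ^ n)"
    by real_asymp
  from landau_o.big.mult[OF this landau_o.big_refl[of "\<lambda>n. (1 / 2) ^ n"]]
  have "(\<lambda>n. real n powr r / 2 ^ n) \<in> O(\<lambda>n. (3 / 4) ^ n)"
    by (simp add: power_divide flip: power_mult_distrib)
  moreover have "summable (\<lambda>n. norm ((3 / 4 :: real) ^ n))"
    by (simp add: summable_geometric)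
  ultimately have "summable (\<lambda>n. real n powr r / 2 ^ n)"
    by (rule summable_comparison_test_bigo[rotated])
  then show ?thesis
    by (subst summable_Suc_iff)
qed

text \<open>The bound depends on \<open>s\<close> only through the radius \<open>r\<close>, as the
  M-test on discs requires.\<close>

lemma norm_L_term_le:
  assumes "norm s \<le> r"
  shows "norm (L_term s (Suc n)) \<le> real (Suc n) powr r / 2 ^ Suc n"
proof -
  have "norm (of_nat (Suc n) powr (- s)) = real (Suc n) powr (- Re s)"
    by (subst norm_powr_real_powr) auto
  also have "\<dots> \<le> real (Suc n) powr r"
    using assms abs_Re_le_cmod[of s] by (intro powr_mono) auto
  finally have "norm (of_nat (Suc n) powr (- s)) \<le> real (Suc n) powr r" .
  with norm_a_seq_le[of "Suc n"]
  have "norm (a_seq (Suc n)) * norm (of_nat (Suc n) powr (- s)) \<le>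
      (1 / 2 ^ Suc n) * real (Suc n) powr r"
    by (intro mult_mono) auto
  then show ?thesis
    by (simp add: L_term_def norm_mult)
qed

lemma summable_L_term: "summable (\<lambda>n. L_term s (Suc n))"
  by (rule summable_comparison_test'[OF summable_powr_div_power2[of "norm s"]])
     (rule norm_L_term_le, simp)

lemma L_fun_holomorphic: "L_fun holomorphic_on UNIV"
proof (rule holomorphic_uniform_sequence[OF open_UNIV])
  show "(\<lambda>s. \<Sum>n<N. L_term s (Suc n)) holomorphic_on UNIV" for N
    unfolding L_term_def by (intro holomorphic_intros)
  fix z :: complex
  have "uniform_limit (cball z 1) (\<lambda>N s. \<Sum>n<N. L_term s (Suc n))
      (\<lambda>s. \<Sum>n. L_term s (Suc n)) sequentially"
  \<comment> \<open>The unit disc around \<open>z\<close> lies in the disc of radius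
    \<open>norm z + 1\<close> around 0.\<close>
  proof (rule Weierstrass_m_test[OF _ summable_powr_div_power2[of "norm z + 1"]])
    fix n s
    assume "s \<in> cball z 1"
    then have "norm s \<le> norm z + 1"
      using norm_triangle_ineq2[of s z] by (simp add: dist_norm norm_minus_commute)
    then show "norm (L_term s (Suc n)) \<le> real (Suc n) powr (norm z + 1) / 2 ^ Suc n"
      by (rule norm_L_term_le)
  qed
  then show "\<exists>d>0. cball z d \<subseteq> UNIV \<and>
      uniform_limit (cball z d) (\<lambda>N s. \<Sum>n<N. L_term s (Suc n)) L_fun sequentially"
    by (intro exI[of _ 1]) (simp add: L_fun_def [abs_def])
qed

text \<open>At arguments at least 1 every monomial is dominated by the one of top degree, so the
  polynomial is at most \<open>?C\<close> times that power.\<close>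

lemma summable_norm_L_star_term: "summable (\<lambda>n. norm (L_star_term f (Suc n)))"
proof (rule summable_comparison_test')
  let ?d = "degree f"
  let ?C = "\<Sum>i\<le>?d. norm (coeff f i)"
  show "summable (\<lambda>n. ?C * (real (Suc n) powr ?d / 2 ^ Suc n))"
    by (intro summable_mult summable_powr_div_power2)
  fix n :: nat
  have "norm (poly f (of_nat (Suc n))) \<le> (\<Sum>i\<le>?d. norm (coeff f i) * real (Suc n) ^ i)"
    unfolding poly_altdef
    by (rule order_trans[OF norm_sum]) (simp add: norm_mult norm_power del: of_nat_Suc)
  also have "\<dots> \<le> (\<Sum>i\<le>?d. norm (coeff f i) * real (Suc n) ^ ?d)"
    by (intro sum_mono mult_left_mono power_increasing) auto
  finally have "norm (poly f (of_nat (Suc n))) \<le> ?C * real (Suc n) powr ?d"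
    by (simp add: sum_distrib_right powr_realpow del: of_nat_Suc)
  with norm_a_seq_le[of "Suc n"]
  have "norm (a_seq (Suc n)) * norm (poly f (of_nat (Suc n))) \<le>
      (1 / 2 ^ Suc n) * (?C * real (Suc n) powr ?d)"
    by (intro mult_mono) auto
  then show "norm (norm (L_star_term f (Suc n))) \<le> ?C * (real (Suc n) powr ?d / 2 ^ Suc n)"
    by (simp add: L_star_term_def norm_mult)
qed

lemma L_star_linear: "Vector_Spaces.linear smult (*) L_star"
proof -
  \<comment> \<open>Termwise addition and scaling of \<open>suminf\<close> need convergence, here
    obtained from absolute convergence.\<close>
  note s = summable_norm_cancel[OF summable_norm_L_star_term]
  have "L_star (f + g) = L_star f + L_star g" for f g
    unfolding L_star_def suminf_add[OF s s]
    by (simp add: L_star_term_def algebra_simps)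
  moreover have "L_star (smult c f) = c * L_star f" for c f
    unfolding L_star_def suminf_mult[OF s, symmetric]
    by (simp add: L_star_term_def algebra_simps)
  ultimately show ?thesis
    by unfold_locales (auto simp: smult_add_right smult_add_left algebra_simps)
qed

lemma L_star_1: "L_star 1 = complex_of_real (ln (pi / 2))"
  using sums_of_real[OF a_seq_sums, where 'a = complex]
  by (simp add: L_star_def L_star_term_def sums_iff)

text \<open>The shifted index keeps the base nonzero, so \<open>powr 0\<close> is 1 in every
  term.\<close>

lemma L_fun_0: "L_fun 0 = L_star 1"
  by (simp add: L_fun_def L_star_def L_term_def L_star_term_def del: of_nat_Suc)

theorem theorem1p1:
  shows
    "((\<forall>s. summable (\<lambda>n. L_term s (Suc n))) \<and> L_fun holomorphic_on UNIV \<and>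
      a_seq \<in> o[at_top](\<lambda>n. 1 / 2 ^ n)) \<and>
     ((\<forall>n\<ge>1. l_seq n \<in> {0<..ln 2}) \<and> strict_antimono_on {1..} l_seq \<and>
      l_seq \<longlonglongrightarrow> 0) \<and>
     (Vector_Spaces.linear smult (*) L_star \<and>
      (\<forall>f. summable (\<lambda>n. norm (L_star_term f (Suc n))))) \<and>
     (L_fun 0 = L_star 1 \<and> L_star 1 = complex_of_real (ln (pi / 2)))"
  using summable_L_term L_fun_holomorphic a_seq_smallo l_seq_range l_seq_strict_antimono
    l_seq_tendsto_0 L_star_linear summable_norm_L_star_term L_fun_0 L_star_1
  by blast

end
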